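(* Let $M\ge 1$ be an integer. Let $f_{j_u,j_v,j_w}$ be a complex three-index sequence that is periodic in each index with period $M$, and let $A_{j'_u,j'_v,j'_w,j''_u,j''_v,j''_w}$ be a complex six-index array that is periodic in each index with period $M$. Define, for integers $j_u,j_v,j_w$, $$I_{j_u,j_v,j_w}=\sum_{j'_u,j'_v,j'_w=0}^{M-1}\ \sum_{j''_u,j''_v,j''_w=0}^{M-1} f_{j'_u-j_u,\,j'_v-j_v,\,j'_w-j_w}\; f_{j''_u-j_u,\,j''_v-j_v,\,j''_w-j_w}\; A_{j'_u,j'_v,j'_w,j''_u,j''_v,j''_w}.$$ Then the three-dimensional discrete Fourier transform of $I$ satisfies, for all $k_u,k_v,k_w$, $$\mathcal{F}[I]_{k_u,k_v,k_w}=M^3\sum_{l_u,l_v,l_w=0}^{M-1}\mathcal{F}^{-1}[f]_{k_u-l_u,\,k_v-l_v,\,k_w-l_w}\;\mathcal{F}^{-1}[f]_{l_u,l_v,l_w}\;\mathcal{F}[A]_{k_u-l_u,\,k_v-l_v,\,k_w-l_w,\,l_u,l_v,l_w}.$$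
   Context: Let $W=e^{-\imath 2\pi/M}$, where $\imath$ is the imaginary unit. For a $d$-index array $x_{n_1,\dots,n_d}$ that is $M$-periodic in each index, the discrete Fourier transform and its inverse are $$\mathcal{F}[x]_{k_1,\dots,k_d}=\sum_{n_1=0}^{M-1}\cdots\sum_{n_d=0}^{M-1}W^{k_1n_1+\cdots+k_dn_d}\,x_{n_1,\dots,n_d},$$ $$\mathcal{F}^{-1}[x]_{l_1,\dots,l_d}=\frac{1}{M^d}\sum_{k_1=0}^{M-1}\cdots\sum_{k_d=0}^{M-1}W^{-(l_1k_1+\cdots+l_dk_d)}\,x_{k_1,\dots,k_d}.$$ These formulas define arrays that are $M$-periodic in each index, so all indices may be any integers. In the theorem, $\mathcal{F}[I]$ and $\mathcal{F}^{-1}[f]$ are three-dimensional transforms ($d=3$) and $\mathcal{F}[A]$ is the six-dimensional transform ($d=6$), with indices in the same order as those of $A$. *)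

theory Defs
  imports Complex_Main
begin

definition dft_root :: "nat \<Rightarrow> complex" where
  "dft_root M = exp (- (\<i> * 2 * of_real pi / of_nat M))"

definition periodic3 :: "nat \<Rightarrow> (int \<Rightarrow> int \<Rightarrow> int \<Rightarrow> complex) \<Rightarrow> bool" where
  "periodic3 M x \<longleftrightarrow> (\<forall>a b c.
     x (a + int M) b c = x a b c \<and>
     x a (b + int M) c = x a b c \<and>
     x a b (c + int M) = x a b c)"

definition periodic6 ::
  "nat \<Rightarrow> (int \<Rightarrow> int \<Rightarrow> int \<Rightarrow> int \<Rightarrow> int \<Rightarrow> int \<Rightarrow> complex) \<Rightarrow> bool" where
  "periodic6 M x \<longleftrightarrow> (\<forall>a b c d e g.
     x (a + int M) b c d e g = x a b c d e g \<and>
     x a (b + int M) c d e g = x a b c d e g \<and>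
     x a b (c + int M) d e g = x a b c d e g \<and>
     x a b c (d + int M) e g = x a b c d e g \<and>
     x a b c d (e + int M) g = x a b c d e g \<and>
     x a b c d e (g + int M) = x a b c d e g)"

text \<open>The \<open>d\<close>-dimensional transform is written out for the two ranks in use, \<open>d = 3\<close> and
  \<open>d = 6\<close>. Periodic multi-index arrays are curried functions on all of \<open>int\<close>, so differences
  of indices need no reduction modulo \<open>M\<close>.\<close>

definition dft3 ::
  "nat \<Rightarrow> (int \<Rightarrow> int \<Rightarrow> int \<Rightarrow> complex) \<Rightarrow> int \<Rightarrow> int \<Rightarrow> int \<Rightarrow> complex" where
  "dft3 M x k1 k2 k3 =
     (\<Sum>n1 = 0..<int M. \<Sum>n2 = 0..<int M. \<Sum>n3 = 0..<int M.
        dft_root M powi (k1 * n1 + k2 * n2 + k3 * n3) * x n1 n2 n3)"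

definition idft3 ::
  "nat \<Rightarrow> (int \<Rightarrow> int \<Rightarrow> int \<Rightarrow> complex) \<Rightarrow> int \<Rightarrow> int \<Rightarrow> int \<Rightarrow> complex" where
  "idft3 M x l1 l2 l3 =
     1 / of_nat M ^ 3 *
     (\<Sum>k1 = 0..<int M. \<Sum>k2 = 0..<int M. \<Sum>k3 = 0..<int M.
        dft_root M powi (- (l1 * k1 + l2 * k2 + l3 * k3)) * x k1 k2 k3)"

definition dft6 ::
  "nat \<Rightarrow> (int \<Rightarrow> int \<Rightarrow> int \<Rightarrow> int \<Rightarrow> int \<Rightarrow> int \<Rightarrow> complex)
     \<Rightarrow> int \<Rightarrow> int \<Rightarrow> int \<Rightarrow> int \<Rightarrow> int \<Rightarrow> int \<Rightarrow> complex" where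
  "dft6 M x k1 k2 k3 k4 k5 k6 =
     (\<Sum>n1 = 0..<int M. \<Sum>n2 = 0..<int M. \<Sum>n3 = 0..<int M.
      \<Sum>n4 = 0..<int M. \<Sum>n5 = 0..<int M. \<Sum>n6 = 0..<int M.
        dft_root M powi (k1 * n1 + k2 * n2 + k3 * n3 + k4 * n4 + k5 * n5 + k6 * n6)
          * x n1 n2 n3 n4 n5 n6)"

end

theory Submission
  imports Defs "HOL-Library.Product_Plus"
begin

text \<open>
  The indices come in triples, so everything is rewritten as sums over the box
  \<open>{0..<M}\<^sup>3\<close> against the characters \<open>\<chi>\<^sub>k(n) = W\<^bsup>k\<cdot>n\<^esup>\<close>, which turn addition in
  either argument into multiplication. Both sides of the claim are linear in the array \<open>A\<close>, so it
  suffices to match the coefficients of each entry \<open>A(p, q)\<close>. With \<open>g\<close> the inverse transform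
  of \<open>f\<close>, this is the identity (\<open>dft_shifted_product\<close>)
  \[ \sum_j \chi_k(j) f(p-j) f(q-j) = M^3 \sum_l g(k-l)\, g(l)\, \chi_{k-l}(p)\, \chi_l(q). \]
  It is the convolution theorem, with the shifts by \<open>p\<close> and \<open>q\<close> appearing as modulations. To
  see it, expand both copies of \<open>g\<close> on the right as sums over \<open>x\<close> and \<open>y\<close>. The sum over \<open>l\<close> can
  then be performed, and by orthogonality of characters (\<open>sum_chi_delta\<close>) it forces \<open>y \<equiv> q - p + x\<close> modulo \<open>M\<close>.
  What is left is a single sum over \<open>x\<close>, and the reflection \<open>x = p - j\<close>
  (\<open>sum_box_reflect\<close>), harmless because the summand is periodic, turns it into the left-hand side.
\<close>

section \<open>Characters and periodic functions in one variable\<close>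

lemma dft_root_nonzero: "dft_root M \<noteq> 0"
  by (simp add: dft_root_def)

lemma dft_root_powi_eq_cis: "dft_root M powi n = cis (- (2 * pi * of_int n / of_nat M))"
proof -
  have "dft_root M = cis (- (2 * pi / of_nat M))"
    by (simp add: dft_root_def cis_conv_exp algebra_simps)
  thus ?thesis by (simp add: cis_power_int algebra_simps)
qed

lemma dft_root_powi_eq_1_iff:
  assumes "M \<ge> 1"
  shows "dft_root M powi n = 1 \<longleftrightarrow> int M dvd n"
proof
  assume "dft_root M powi n = 1"
  hence "cos (2 * pi * of_int n / of_nat M) = 1"
    unfolding dft_root_powi_eq_cis by (metis cis.sel(1) cos_minus one_complex.sel(1))
  then obtain m :: int where "2 * pi * of_int n / of_nat M = of_int m * 2 * pi"
    unfolding cos_one_2pi_int by blast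
  hence "of_int n = (of_int (m * int M) :: real)"
    using assms by (simp add: field_simps)
  hence "n = m * int M" by (simp only: of_int_eq_iff)
  thus "int M dvd n" by simp
next
  assume "int M dvd n"
  then obtain m where "n = int M * m" by blast
  hence "2 * pi * of_int n / of_nat M = 2 * pi * of_int m"
    using assms by simp
  thus "dft_root M powi n = 1"
    unfolding dft_root_powi_eq_cis by (simp add: complex_eq_iff)
qed

text \<open>A geometric sum whose ratio \<open>W\<^bsup>n\<^esup>\<close> is an \<open>M\<close>-th root of unity.\<close>

lemma sum_dft_root_powi:
  assumes "M \<ge> 1"
  shows "(\<Sum>l = 0..<int M. dft_root M powi (l * n)) = (if int M dvd n then of_nat M else 0)"
proof -
  define r where "r = dft_root M powi n"
  have "dft_root M powi (l * n) = r powi l" for l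
    unfolding r_def by (metis mult.commute power_int_mult)
  moreover have "(\<Sum>l = 0..<int M. r powi l) = (\<Sum>i<M. r ^ i)"
    by (rule sum.reindex_bij_witness[of _ int nat]) (auto simp flip: power_int_of_nat)
  ultimately have "(\<Sum>l = 0..<int M. dft_root M powi (l * n)) = (\<Sum>i<M. r ^ i)"
    by simp
  moreover have "r ^ M = 1"
    using dft_root_powi_eq_1_iff[OF assms, of "n * int M"]
    by (simp add: r_def power_int_mult)
  ultimately show ?thesis
    using dft_root_powi_eq_1_iff[OF assms, of n] by (auto simp: r_def geometric_sum)
qed

lemma periodic_add_multiple:
  fixes h :: "int \<Rightarrow> 'a"
  assumes "\<And>a. h (a + int M) = h a"
  shows "h (a + int M * n) = h a"
proof (induction n rule: int_induct[where k = 0])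
  case (step1 i)
  thus ?case using assms[of "a + int M * i"] by (simp add: algebra_simps)
next
  case (step2 i)
  thus ?case using assms[of "a + int M * (i - 1)"] by (simp add: algebra_simps)
qed simp

lemma periodic_mod:
  fixes h :: "int \<Rightarrow> 'a"
  assumes "\<And>a. h (a + int M) = h a"
  shows "h (a mod int M) = h a"
  using periodic_add_multiple[of h M "a mod int M" "a div int M"] assms by simp

text \<open>Reducing \<open>t - x\<close> modulo \<open>M\<close> is an involution of the period interval.\<close>

lemma sum_period_reflect:
  fixes h :: "int \<Rightarrow> 'a :: comm_monoid_add"
  assumes "M \<ge> 1" and per: "\<And>a. h (a + int M) = h a"
  shows "(\<Sum>x = 0..<int M. h (t - x)) = (\<Sum>x = 0..<int M. h x)"
proof (rule sum.reindex_bij_witness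
    [of _ "\<lambda>x. (t - x) mod int M" "\<lambda>x. (t - x) mod int M"])
  show "h ((t - a) mod int M) = h (t - a)" for a
    using periodic_mod[of h M] per by blast
qed (use assms(1) in \<open>auto simp: mod_diff_right_eq\<close>)

section \<open>Index triples\<close>

type_synonym index3 = "int \<times> int \<times> int"

definition box :: "nat \<Rightarrow> index3 set" where
  "box M = {0..<int M} \<times> {0..<int M} \<times> {0..<int M}"

fun on_triple :: "(int \<Rightarrow> int \<Rightarrow> int \<Rightarrow> 'a) \<Rightarrow> index3 \<Rightarrow> 'a" where
  "on_triple x (a, b, c) = x a b c"

fun dot3 :: "index3 \<Rightarrow> index3 \<Rightarrow> int" where
  "dot3 (a, b, c) (x, y, z) = a * x + b * y + c * z"

definition chi :: "nat \<Rightarrow> index3 \<Rightarrow> index3 \<Rightarrow> complex" where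
  "chi M k n = dft_root M powi dot3 k n"

definition idft_box :: "nat \<Rightarrow> (index3 \<Rightarrow> complex) \<Rightarrow> index3 \<Rightarrow> complex" where
  "idft_box M F l = 1 / of_nat M ^ 3 * (\<Sum>n\<in>box M. chi M (- l) n * F n)"

definition periodic_triple :: "nat \<Rightarrow> (index3 \<Rightarrow> 'a) \<Rightarrow> bool" where
  "periodic_triple M F \<longleftrightarrow> (\<forall>a b c.
     F (a + int M, b, c) = F (a, b, c) \<and>
     F (a, b + int M, c) = F (a, b, c) \<and>
     F (a, b, c + int M) = F (a, b, c))"

lemma finite_box [simp]: "finite (box M)"
  by (simp add: box_def)

lemma sum_box:
  "(\<Sum>n\<in>box M. F n) = (\<Sum>a = 0..<int M. \<Sum>b = 0..<int M. \<Sum>c = 0..<int M. F (a, b, c))"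
  by (simp add: box_def sum.cartesian_product case_prod_unfold)

lemma sum_rotate:
  "(\<Sum>x\<in>A. \<Sum>y\<in>B. \<Sum>z\<in>C. T x y z) = (\<Sum>z\<in>C. \<Sum>x\<in>A. \<Sum>y\<in>B. T x y z)"
  by (simp only: sum.swap[of _ C])

lemma dot3_left_diff: "dot3 (k - l) n = dot3 k n - dot3 l n"
  by (cases k; cases l; cases n) (simp add: algebra_simps)

lemma dot3_right_diff: "dot3 k (m - n) = dot3 k m - dot3 k n"
  by (cases k; cases m; cases n) (simp add: algebra_simps)

lemma dot3_right_add: "dot3 k (m + n) = dot3 k m + dot3 k n"
  by (cases k; cases m; cases n) (simp add: algebra_simps)

lemma dot3_left_minus: "dot3 (- k) n = - dot3 k n"
  by (cases k; cases n) simp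

lemma periodic_chi:
  assumes "M \<ge> 1"
  shows "periodic_triple M (chi M k)"
proof (cases k)
  case (fields k1 k2 k3)
  have "dft_root M powi (i + int M * j) = dft_root M powi i" for i j
    using dft_root_powi_eq_1_iff[OF assms, of "int M * j"]
    by (simp add: power_int_add dft_root_nonzero)
  note shift = this
  have "k1 * (a + int M) + k2 * b + k3 * c = (k1 * a + k2 * b + k3 * c) + int M * k1"
    "k1 * a + k2 * (b + int M) + k3 * c = (k1 * a + k2 * b + k3 * c) + int M * k2"
    "k1 * a + k2 * b + k3 * (c + int M) = (k1 * a + k2 * b + k3 * c) + int M * k3"
    for a b c by (simp_all add: algebra_simps)
  thus ?thesis by (simp only: periodic_triple_def chi_def fields dot3.simps shift simp_thms)
qed

text \<open>The character factors over the three coordinates, so this is three copies of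
  the one-dimensional orthogonality relation.\<close>

lemma sum_chi:
  assumes "M \<ge> 1"
  shows "(\<Sum>l\<in>box M. chi M l (a, b, c)) =
    (if int M dvd a \<and> int M dvd b \<and> int M dvd c then of_nat M ^ 3 else 0)"
proof -
  have "(\<Sum>l\<in>box M. chi M l (a, b, c)) =
      (\<Sum>l = 0..<int M. dft_root M powi (l * a)) *
      ((\<Sum>l = 0..<int M. dft_root M powi (l * b)) *
       (\<Sum>l = 0..<int M. dft_root M powi (l * c)))"
    unfolding sum_distrib_right unfolding sum_distrib_left
    by (simp add: sum_box chi_def power_int_add dft_root_nonzero mult.assoc)
  thus ?thesis by (simp add: sum_dft_root_powi[OF assms] power3_eq_cube)
qed

lemma periodic_triple_mod:
  assumes "periodic_triple M F"
  shows "F (a mod int M, b mod int M, c mod int M) = F (a, b, c)"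
proof -
  have "F (a mod int M, b', c') = F (a, b', c')" for b' c'
    using periodic_mod[of "\<lambda>x. F (x, b', c')" M a] assms
    by (simp add: periodic_triple_def)
  moreover have "F (a, b mod int M, c') = F (a, b, c')" for c'
    using periodic_mod[of "\<lambda>x. F (a, x, c')" M b] assms
    by (simp add: periodic_triple_def)
  moreover have "F (a, b, c mod int M) = F (a, b, c)"
    using periodic_mod[of "\<lambda>x. F (a, b, x)" M c] assms
    by (simp add: periodic_triple_def)
  ultimately show ?thesis by simp
qed

text \<open>Summing over the dual index makes a discrete delta: among the \<open>y\<close> in the box, only the
  residue of \<open>n\<close> survives.\<close>

lemma sum_chi_delta:
  assumes "M \<ge> 1" and "periodic_triple M F"
  shows "(\<Sum>y\<in>box M. F y * (\<Sum>l\<in>box M. chi M l (n - y))) = of_nat M ^ 3 * F n"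
proof -
  obtain a b c where n: "n = (a, b, c)" by (cases n)
  let ?m = "(a mod int M, b mod int M, c mod int M)"
  have res: "int M dvd u - v \<longleftrightarrow> v = u mod int M" if "v \<in> {0..<int M}" for u v
    using that by (auto simp flip: mod_eq_dvd_iff)
  have "(\<Sum>l\<in>box M. chi M l (n - y)) = (if y = ?m then of_nat M ^ 3 else 0)"
    if "y \<in> box M" for y
  proof (cases y)
    case (fields u v w)
    with that have "u \<in> {0..<int M}" "v \<in> {0..<int M}" "w \<in> {0..<int M}"
      by (simp_all add: box_def)
    thus ?thesis by (simp add: fields n sum_chi[OF assms(1)] res)
  qed
  hence "(\<Sum>y\<in>box M. F y * (\<Sum>l\<in>box M. chi M l (n - y))) =
      (\<Sum>y\<in>box M. if y = ?m then F y * of_nat M ^ 3 else 0)"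
    by (intro sum.cong) auto
  moreover have "?m \<in> box M"
    using assms(1) by (simp add: box_def)
  ultimately show ?thesis
    by (simp add: n periodic_triple_mod[OF assms(2)])
qed

lemma sum_box_reflect:
  fixes F :: "index3 \<Rightarrow> 'a :: comm_monoid_add"
  assumes "M \<ge> 1" and "periodic_triple M F"
  shows "(\<Sum>x\<in>box M. F (t - x)) = (\<Sum>x\<in>box M. F x)"
proof (cases t)
  case (fields a b c)
  have per: "F (u + int M, v, w) = F (u, v, w)" "F (u, v + int M, w) = F (u, v, w)"
    "F (u, v, w + int M) = F (u, v, w)" for u v w
    using assms(2) by (simp_all add: periodic_triple_def)
  have "(\<Sum>x\<in>box M. F (t - x)) =
      (\<Sum>x = 0..<int M. \<Sum>y = 0..<int M. \<Sum>z = 0..<int M. F (a - x, b - y, c - z))"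
    by (simp add: sum_box fields)
  also have "\<dots> = (\<Sum>x = 0..<int M. \<Sum>y = 0..<int M. \<Sum>z = 0..<int M. F (a - x, b - y, z))"
    by (intro sum.cong refl sum_period_reflect[OF assms(1)] per)
  also have "\<dots> = (\<Sum>x = 0..<int M. \<Sum>y = 0..<int M. \<Sum>z = 0..<int M. F (a - x, y, z))"
    by (intro sum.cong refl
        sum_period_reflect[OF assms(1), of "\<lambda>y. \<Sum>z = 0..<int M. F (_, y, z)"]) (simp add: per)
  also have "\<dots> = (\<Sum>x = 0..<int M. \<Sum>y = 0..<int M. \<Sum>z = 0..<int M. F (x, y, z))"
    by (rule sum_period_reflect[OF assms(1),
          of "\<lambda>x. \<Sum>y = 0..<int M. \<Sum>z = 0..<int M. F (x, y, z)"]) (simp add: per)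
  finally show ?thesis by (simp add: sum_box)
qed

lemma periodic_triple_mult:
  assumes "periodic_triple M F" and "periodic_triple M G"
  shows "periodic_triple M (\<lambda>x. F x * G x :: 'a :: times)"
  using assms by (simp add: periodic_triple_def)

lemma periodic_triple_translate:
  assumes "periodic_triple M F"
  shows "periodic_triple M (\<lambda>x. F (t + x))"
  using assms by (cases t) (simp add: periodic_triple_def flip: add.assoc)

lemma periodic_triple_minus:
  assumes "periodic_triple M F"
  shows "periodic_triple M (\<lambda>x. F (- x))"
proof -
  have "F (- u - int M, v, w) = F (- u, v, w)" "F (u, - v - int M, w) = F (u, - v, w)"
    "F (u, v, - w - int M) = F (u, v, - w)" for u v w
    using assms unfolding periodic_triple_def
    by (metis diff_add_cancel)+
  thus ?thesis by (simp add: periodic_triple_def)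
qed

section \<open>The convolution theorem with modulations\<close>

text \<open>A product on one side becomes a convolution on the other. A shift of \<open>F\<close> by \<open>p\<close>
  becomes a factor \<open>\<chi>(p)\<close>; and since \<open>F\<close> is reflected to \<open>F(p - j)\<close>, the inverse transform of
  \<open>F\<close> appears in place of the forward one.\<close>

lemma dft_shifted_product:
  assumes "M \<ge> 1" and per: "periodic_triple M F"
  shows "(\<Sum>j\<in>box M. chi M k j * (F (p - j) * F (q - j))) =
    of_nat M ^ 3 *
      (\<Sum>l\<in>box M. idft_box M F (k - l) * idft_box M F l * (chi M (k - l) p * chi M l q))"
proof -
  let ?N = "of_nat M ^ 3 :: complex"
  have N: "?N \<noteq> 0" using assms(1) by simp
  have cancel: "z * (1 / z^2 * s) = 1 / z * s" if "z \<noteq> 0" for z s :: complex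
    using that by (simp add: power2_eq_square)
  \<comment> \<open>Collect the exponents: the factors carrying \<open>l\<close> form one character at \<open>q - p + x - y\<close>.\<close>
  have phase: "chi M (- (k - l)) x * chi M (- l) y * (chi M (k - l) p * chi M l q) =
      chi M k (p - x) * chi M l (q - p + x - y)" for l x y
    by (simp add: chi_def dft_root_nonzero dot3_left_diff dot3_right_diff dot3_right_add
        dot3_left_minus algebra_simps flip: power_int_add)
  have term_expand:
    "idft_box M F (k - l) * idft_box M F l * (chi M (k - l) p * chi M l q) =
      1 / ?N^2 * (\<Sum>x\<in>box M. \<Sum>y\<in>box M.
        F x * chi M k (p - x) * (F y * chi M l (q - p + x - y)))" for l
  proof -
    have "idft_box M F (k - l) * idft_box M F l * (chi M (k - l) p * chi M l q) =
      1 / ?N^2 * (((\<Sum>x\<in>box M. chi M (- (k - l)) x * F x) *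
        (\<Sum>y\<in>box M. chi M (- l) y * F y)) * (chi M (k - l) p * chi M l q))"
      by (simp add: idft_box_def power2_eq_square mult_ac)
    also have "\<dots> = 1 / ?N^2 * (\<Sum>x\<in>box M. \<Sum>y\<in>box M. F x * F y *
        (chi M (- (k - l)) x * chi M (- l) y * (chi M (k - l) p * chi M l q)))"
      unfolding sum_product unfolding sum_distrib_right by (simp only: mult_ac)
    finally show ?thesis unfolding phase by (simp only: mult_ac)
  qed
  have "?N * (\<Sum>l\<in>box M. idft_box M F (k - l) * idft_box M F l * (chi M (k - l) p * chi M l q))
      = 1 / ?N * (\<Sum>l\<in>box M. \<Sum>x\<in>box M. \<Sum>y\<in>box M.
          F x * chi M k (p - x) * (F y * chi M l (q - p + x - y)))"
    unfolding term_expand sum_distrib_left[of "1 / ?N^2", symmetric] by (rule cancel[OF N])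
  also have "(\<Sum>l\<in>box M. \<Sum>x\<in>box M. \<Sum>y\<in>box M.
        F x * chi M k (p - x) * (F y * chi M l (q - p + x - y))) =
      (\<Sum>x\<in>box M. \<Sum>y\<in>box M. \<Sum>l\<in>box M.
        F x * chi M k (p - x) * (F y * chi M l (q - p + x - y)))"
    by (rule sum_rotate[symmetric])
  also have "\<dots> = (\<Sum>x\<in>box M. F x * chi M k (p - x) *
        (\<Sum>y\<in>box M. F y * (\<Sum>l\<in>box M. chi M l (q - p + x - y))))"
    by (simp only: sum_distrib_left)
  also have "\<dots> = (\<Sum>x\<in>box M. F x * chi M k (p - x) * (?N * F (q - p + x)))"
    by (simp only: sum_chi_delta[OF assms])
  \<comment> \<open>Of the two normalising factors and the prefactor, exactly one \<open>1 / M\<^sup>3\<close> was left, and the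
    delta cancels it.\<close>
  also have "1 / ?N * \<dots> = (\<Sum>x\<in>box M. chi M k (p - x) * (F x * F (q - p + x)))"
    using N by (simp add: sum_distrib_left mult_ac)
  also have "\<dots> = (\<Sum>j\<in>box M. chi M k (p - (p - j)) * (F (p - j) * F (q - p + (p - j))))"
  proof (rule sum_box_reflect[OF assms(1), symmetric])
    have "periodic_triple M (\<lambda>x. chi M k (p + - x))"
      using periodic_triple_minus[OF periodic_triple_translate[OF periodic_chi[OF assms(1)]]] .
    thus "periodic_triple M (\<lambda>x. chi M k (p - x) * (F x * F (q - p + x)))"
      by (intro periodic_triple_mult per periodic_triple_translate) simp
  qed
  also have "\<dots> = (\<Sum>j\<in>box M. chi M k j * (F (p - j) * F (q - j)))"
    by (simp add: algebra_simps)
  finally show ?thesis by simp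
qed

section \<open>Transforms of index triples and the theorem\<close>

lemma dft3_eq: "dft3 M x a b c = (\<Sum>n\<in>box M. chi M (a, b, c) n * on_triple x n)"
  by (simp add: dft3_def sum_box chi_def)

lemma idft3_eq: "idft3 M x a b c = idft_box M (on_triple x) (a, b, c)"
proof -
  have "- (a * u + b * v + c * w) = - a * u + - b * v + - c * w" for u v w by simp
  thus ?thesis by (simp only: idft3_def idft_box_def sum_box chi_def on_triple.simps
        uminus_Pair dot3.simps)
qed

lemma dft6_eq:
  "dft6 M X a b c d e g = (\<Sum>p\<in>box M. \<Sum>q\<in>box M.
     chi M (a, b, c) p * chi M (d, e, g) q * on_triple (on_triple X p) q)"
  by (simp add: dft6_def sum_box chi_def dft_root_nonzero add.assoc flip: power_int_add)

theorem theorem3p1: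
  fixes M :: nat
    and f I :: "int \<Rightarrow> int \<Rightarrow> int \<Rightarrow> complex"
    and A :: "int \<Rightarrow> int \<Rightarrow> int \<Rightarrow> int \<Rightarrow> int \<Rightarrow> int \<Rightarrow> complex"
  assumes "M \<ge> 1"
    and "periodic3 M f"
    and "periodic6 M A"
    and "\<And>ju jv jw. I ju jv jw =
      (\<Sum>pu = 0..<int M. \<Sum>pv = 0..<int M. \<Sum>pw = 0..<int M.
       \<Sum>qu = 0..<int M. \<Sum>qv = 0..<int M. \<Sum>qw = 0..<int M.
         f (pu - ju) (pv - jv) (pw - jw) * f (qu - ju) (qv - jv) (qw - jw)
           * A pu pv pw qu qv qw)"
  shows "\<forall>ku kv kw. dft3 M I ku kv kw =
    of_nat M ^ 3 *
      (\<Sum>lu = 0..<int M. \<Sum>lv = 0..<int M. \<Sum>lw = 0..<int M.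
         idft3 M f (ku - lu) (kv - lv) (kw - lw) * idft3 M f lu lv lw
           * dft6 M A (ku - lu) (kv - lv) (kw - lw) lu lv lw)"
proof (intro allI)
  fix ku kv kw :: int
  define k where "k = (ku, kv, kw)"
  define F where "F = on_triple f"
  define B where "B p q = on_triple (on_triple A p) q" for p q
  let ?g = "idft_box M F"
  have per: "periodic_triple M F"
    using assms(2) by (simp add: F_def periodic_triple_def periodic3_def)
  have I: "on_triple I j = (\<Sum>p\<in>box M. \<Sum>q\<in>box M. F (p - j) * F (q - j) * B p q)" for j
    by (cases j) (simp add: assms(4) sum_box F_def B_def)
  have "dft3 M I ku kv kw =
      (\<Sum>j\<in>box M. \<Sum>p\<in>box M. \<Sum>q\<in>box M. chi M k j * (F (p - j) * F (q - j)) * B p q)"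
    unfolding dft3_eq I k_def[symmetric] by (simp only: sum_distrib_left mult.assoc)
  also have "\<dots> = (\<Sum>p\<in>box M. \<Sum>q\<in>box M. \<Sum>j\<in>box M.
      chi M k j * (F (p - j) * F (q - j)) * B p q)"
    by (rule sum_rotate[symmetric])
  also have "\<dots> = (\<Sum>p\<in>box M. \<Sum>q\<in>box M. \<Sum>l\<in>box M. of_nat M ^ 3 *
      (?g (k - l) * ?g l * (chi M (k - l) p * chi M l q)) * B p q)"
    by (simp only: dft_shifted_product[OF assms(1) per] sum_distrib_left flip: sum_distrib_right)
  also have "\<dots> = (\<Sum>l\<in>box M. \<Sum>p\<in>box M. \<Sum>q\<in>box M. of_nat M ^ 3 *
      (?g (k - l) * ?g l * (chi M (k - l) p * chi M l q)) * B p q)"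
    by (rule sum_rotate)
  also have "\<dots> = of_nat M ^ 3 * (\<Sum>l\<in>box M. ?g (k - l) * ?g l *
      (\<Sum>p\<in>box M. \<Sum>q\<in>box M. chi M (k - l) p * chi M l q * B p q))"
    by (simp only: sum_distrib_left mult.assoc)
  also have "\<dots> = of_nat M ^ 3 *
      (\<Sum>lu = 0..<int M. \<Sum>lv = 0..<int M. \<Sum>lw = 0..<int M.
         idft3 M f (ku - lu) (kv - lv) (kw - lw) * idft3 M f lu lv lw
           * dft6 M A (ku - lu) (kv - lv) (kw - lw) lu lv lw)"
    unfolding idft3_eq dft6_eq k_def F_def B_def by (subst sum_box) simp
  finally show "dft3 M I ku kv kw = of_nat M ^ 3 *
      (\<Sum>lu = 0..<int M. \<Sum>lv = 0..<int M. \<Sum>lw = 0..<int M.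
         idft3 M f (ku - lu) (kv - lv) (kw - lw) * idft3 M f lu lv lw
           * dft6 M A (ku - lu) (kv - lv) (kw - lw) lu lv lw)" .
qed

end
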